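(* For the one-dimensional compressible Euler equations in potential temperature formulation, the numerical flux (ETEC flux) $$f^{\mathrm{num}}_{\varrho}=f^{\mathrm{num}}_{\varrho\theta}\,\{\!\{1/\theta\}\!\}_{\log},\qquad f^{\mathrm{num}}_{\varrho v}=f^{\mathrm{num}}_{\varrho}\,\{\!\{v\}\!\}+\{\!\{p\}\!\},\qquad f^{\mathrm{num}}_{\varrho\theta}=\{\!\{\varrho\theta\}\!\}_\gamma\,\{\!\{v\}\!\}$$ is entropy-conservative (EC), total energy-conservative (TEC), kinetic energy preserving (KEP) and pressure equilibrium preserving (PEP). Moreover, it is the only numerical flux with these properties for $v\equiv\mathrm{const}$ (i.e. for pairs of states with equal velocities).
   Context: The equations are $\partial_t(\varrho,\varrho v,\varrho\theta)^T+\partial_x(\varrho v,\varrho v^2+p,\varrho\theta v)^T=0$ with $\varrho>0$, $\theta>0$, $p=K(\varrho\theta)^\gamma$, where $K>0$, $\gamma>1$ are constants. A numerical flux $f^{\mathrm{num}}=(f^{\mathrm{num}}_\varrho,f^{\mathrm{num}}_{\varrho v},f^{\mathrm{num}}_{\varrho\theta})$ is a two-point function of a left state $u_-$ and a right state $u_+$ which is symmetric in its arguments and consistent (equal to the exact flux if $u_-=u_+$). Notation: $[\![a]\!]=a_+-a_-$, $\{\!\{a\}\!\}=(a_++a_-)/2$, $\{\!\{a\}\!\}_{\log}=[\![a]\!]/[\![\log a]\!]$, $\{\!\{a\}\!\}_\gamma=\frac{\gamma-1}{\gamma}\frac{[\![a^\gamma]\!]}{[\![a^{\gamma-1}]\!]}$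 for positive $a_\pm$; the last two means take the value $a$ when $a_+=a_-=a$. Definitions: - EC (conservation of $\varrho\log(p/\varrho^\gamma)$): $[\![\log(\varrho/(\varrho\theta))]\!]\,f^{\mathrm{num}}_\varrho-[\![\varrho/(\varrho\theta)]\!]\,f^{\mathrm{num}}_{\varrho\theta}=0$. - TEC (conservation of $\varrho E=\frac{p}{\gamma-1}+\frac12\varrho v^2$): $-\frac12[\![v^2]\!]f^{\mathrm{num}}_\varrho+[\![v]\!]f^{\mathrm{num}}_{\varrho v}+\frac{\gamma}{\gamma-1}K[\![(\varrho\theta)^{\gamma-1}]\!]f^{\mathrm{num}}_{\varrho\theta}-K[\![(\varrho\theta)^\gamma v]\!]=0$. - KEP: $f^{\mathrm{num}}_{\varrho v}=\{\!\{v\}\!\}f^{\mathrm{num}}_\varrho+\{\!\{p\}\!\}$. - PEP: provided that velocity $v$ and pressure $p$ are constant throughout the domain, $f^{\mathrm{num}}_{\varrho v}=v f^{\mathrm{num}}_\varrho+\mathrm{const}(p,v)$ and $f^{\mathrm{num}}_{\varrho\theta}=\mathrm{const}(\varrho\theta,v)$, where $\mathrm{const}(\cdot,\cdot)$ denotes a quantity depending only on the listed common values and not on the densities (constant $p$ is equivalent to constant $\varrho\theta$).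
   Formalization: Uniqueness is stated for pairs with equal velocities where θ differs, and for all equal-velocity pairs if the flux is continuous there; without continuity it fails at equal v and θ but different ϱ, where adding (1, v, 0) to the flux keeps all the properties. *)

theory Defs
  imports "HOL-Analysis.Analysis"
begin

text \<open>
  A state is the triple of conserved variables
  \<open>(\<rho>, \<rho> v, \<rho> \<theta>)\<close>; a flux value lists the corresponding three components.
\<close>

type_synonym state = "real \<times> real \<times> real"
type_synonym flux = "state \<Rightarrow> state \<Rightarrow> real \<times> real \<times> real"

definition rho :: "state \<Rightarrow> real" where
  "rho u = fst u"

definition rho_v :: "state \<Rightarrow> real" where
  "rho_v u = fst (snd u)"

definition rho_theta :: "state \<Rightarrow> real" where
  "rho_theta u = snd (snd u)"

definition vel :: "state \<Rightarrow> real" where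
  "vel u = rho_v u / rho u"

definition theta :: "state \<Rightarrow> real" where
  "theta u = rho_theta u / rho u"

definition pressure :: "real \<Rightarrow> real \<Rightarrow> state \<Rightarrow> real" where
  "pressure K \<gamma> u = K * rho_theta u powr \<gamma>"

definition states :: "state set" where
  "states = {u. rho u > 0 \<and> theta u > 0}"

definition state_pairs :: "(state \<times> state) set" where
  "state_pairs = states \<times> states"

definition equal_velocity_pairs :: "(state \<times> state) set" where
  "equal_velocity_pairs = {(uL, uR) \<in> state_pairs. vel uL = vel uR}"

definition euler_flux :: "real \<Rightarrow> real \<Rightarrow> state \<Rightarrow> real \<times> real \<times> real" where
  "euler_flux K \<gamma> u =
     (rho u * vel u, rho u * (vel u)\<^sup>2 + pressure K \<gamma> u, rho_theta u * vel u)"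

definition f_rho :: "flux \<Rightarrow> state \<Rightarrow> state \<Rightarrow> real" where
  "f_rho f uL uR = fst (f uL uR)"

definition f_rho_v :: "flux \<Rightarrow> state \<Rightarrow> state \<Rightarrow> real" where
  "f_rho_v f uL uR = fst (snd (f uL uR))"

definition f_rho_theta :: "flux \<Rightarrow> state \<Rightarrow> state \<Rightarrow> real" where
  "f_rho_theta f uL uR = snd (snd (f uL uR))"

definition numerical_flux :: "real \<Rightarrow> real \<Rightarrow> flux \<Rightarrow> bool" where
  "numerical_flux K \<gamma> f \<longleftrightarrow>
     (\<forall>uL\<in>states. \<forall>uR\<in>states. f uL uR = f uR uL) \<and>
     (\<forall>u\<in>states. f u u = euler_flux K \<gamma> u)"

definition jump :: "(state \<Rightarrow> real) \<Rightarrow> state \<Rightarrow> state \<Rightarrow> real" where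
  "jump a uL uR = a uR - a uL"

definition avg :: "(state \<Rightarrow> real) \<Rightarrow> state \<Rightarrow> state \<Rightarrow> real" where
  "avg a uL uR = (a uR + a uL) / 2"

definition log_mean :: "(state \<Rightarrow> real) \<Rightarrow> state \<Rightarrow> state \<Rightarrow> real" where
  "log_mean a uL uR =
     (if a uL = a uR then a uL
      else jump a uL uR / jump (\<lambda>u. ln (a u)) uL uR)"

definition gamma_mean :: "real \<Rightarrow> (state \<Rightarrow> real) \<Rightarrow> state \<Rightarrow> state \<Rightarrow> real" where
  "gamma_mean \<gamma> a uL uR =
     (if a uL = a uR then a uL
      else (\<gamma> - 1) / \<gamma> *
           (jump (\<lambda>u. a u powr \<gamma>) uL uR / jump (\<lambda>u. a u powr (\<gamma> - 1)) uL uR))"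

text \<open>
  The structural properties are relative to a set \<open>D\<close> of pairs (left state, right state), so
  that they can be imposed on all pairs or only on pairs with equal velocities.
\<close>

definition EC_on :: "(state \<times> state) set \<Rightarrow> flux \<Rightarrow> bool" where
  "EC_on D f \<longleftrightarrow> (\<forall>(uL, uR)\<in>D.
     jump (\<lambda>u. ln (rho u / rho_theta u)) uL uR * f_rho f uL uR
     - jump (\<lambda>u. rho u / rho_theta u) uL uR * f_rho_theta f uL uR = 0)"

definition TEC_on :: "real \<Rightarrow> real \<Rightarrow> (state \<times> state) set \<Rightarrow> flux \<Rightarrow> bool" where
  "TEC_on K \<gamma> D f \<longleftrightarrow> (\<forall>(uL, uR)\<in>D.
     - (1 / 2) * jump (\<lambda>u. (vel u)\<^sup>2) uL uR * f_rho f uL uR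
     + jump vel uL uR * f_rho_v f uL uR
     + \<gamma> / (\<gamma> - 1) * K * jump (\<lambda>u. rho_theta u powr (\<gamma> - 1)) uL uR * f_rho_theta f uL uR
     - K * jump (\<lambda>u. rho_theta u powr \<gamma> * vel u) uL uR = 0)"

definition KEP_on :: "real \<Rightarrow> real \<Rightarrow> (state \<times> state) set \<Rightarrow> flux \<Rightarrow> bool" where
  "KEP_on K \<gamma> D f \<longleftrightarrow> (\<forall>(uL, uR)\<in>D.
     f_rho_v f uL uR = avg vel uL uR * f_rho f uL uR + avg (pressure K \<gamma>) uL uR)"

text \<open>
  The functions \<open>c\<close> and \<open>d\<close> are chosen before the pair of states: they are the quantities
  \<open>const(p, v)\<close> and \<open>const(\<rho> \<theta>, v)\<close>, which do not depend on the densities.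
\<close>

definition PEP_on :: "real \<Rightarrow> real \<Rightarrow> (state \<times> state) set \<Rightarrow> flux \<Rightarrow> bool" where
  "PEP_on K \<gamma> D f \<longleftrightarrow> (\<exists>c d :: real \<Rightarrow> real \<Rightarrow> real. \<forall>(uL, uR)\<in>D.
     vel uL = vel uR \<and> pressure K \<gamma> uL = pressure K \<gamma> uR \<longrightarrow>
       f_rho_v f uL uR = vel uL * f_rho f uL uR + c (pressure K \<gamma> uL) (vel uL) \<and>
       f_rho_theta f uL uR = d (rho_theta uL) (vel uL))"

definition etec_flux :: "real \<Rightarrow> real \<Rightarrow> flux" where
  "etec_flux K \<gamma> uL uR =
     (let g_rho_theta = gamma_mean \<gamma> rho_theta uL uR * avg vel uL uR;
          g_rho = g_rho_theta * log_mean (\<lambda>u. 1 / theta u) uL uR;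
          g_rho_v = g_rho * avg vel uL uR + avg (pressure K \<gamma>) uL uR
      in (g_rho, g_rho_v, g_rho_theta))"

text \<open>
  Symmetry and consistency do not imply continuity. At a pair with equal velocities and equal
  \<open>\<theta>\<close> but different densities, the four properties leave \<open>f_rho\<close> undetermined (the jumps in
  EC vanish), so a flux is fixed there only by continuity.
\<close>

definition continuous_flux_on :: "(state \<times> state) set \<Rightarrow> flux \<Rightarrow> bool" where
  "continuous_flux_on D f \<longleftrightarrow> continuous_on D (\<lambda>(uL, uR). f uL uR)"

end

theory Submission
  imports Defs
begin

text \<open>
  The logarithmic mean and the \<open>\<gamma>\<close>-mean are both \<^emph>\<open>Cauchy means\<close>
  \<open>M(a, b) = (F b - F a) / (G b - G a)\<close>, \<open>M(a, a) = a\<close>, of functions on the positive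
  half-line with \<open>F' x = x * G' x\<close> and \<open>G' > 0\<close>: take \<open>F x = x\<close>, \<open>G x = ln x\<close> for the first and
  \<open>F x = (\<gamma> - 1) / \<gamma> * x powr \<gamma>\<close>, \<open>G x = x powr (\<gamma> - 1)\<close> for the second. Three facts about
  Cauchy means carry the proof. They satisfy \<open>(G b - G a) * M(a, b) = F b - F a\<close> also on the
  diagonal (\<open>cauchy_mean_jump\<close>), they are symmetric, and by Cauchy's mean value theorem \<open>M(a, b)\<close>
  lies between \<open>a\<close> and \<open>b\<close>, so that \<open>M\<close> is continuous (\<open>continuous_on_cauchy_mean\<close>).

  The jump identity for \<open>ln\<close> at \<open>1 / \<theta> = \<rho> / (\<rho> \<theta>)\<close>, multiplied by \<open>f_rho_theta\<close>, is EC. The one for \<open>x powr (\<gamma> - 1)\<close> at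
  \<open>\<rho> \<theta>\<close> turns the pressure term of TEC into \<open>K * jump ((\<rho> \<theta>) powr \<gamma>) * avg v\<close>; together with
  KEP and the discrete product rule \<open>jump (a b) = avg a * jump b + jump a * avg b\<close> it gives TEC.
  KEP and PEP can be read off the definition of the flux.

  For uniqueness at equal velocities, TEC is the jump identity of the \<open>\<gamma>\<close>-mean times the velocity,
  which determines \<open>f_rho_theta\<close> when \<open>\<rho> \<theta>\<close> jumps. If \<open>\<rho> \<theta>\<close> does not jump, PEP says that
  \<open>f_rho_theta\<close> is the same as at a pair of identical states, where consistency gives its value.
  Then EC determines \<open>f_rho\<close> as long as \<open>\<theta>\<close> jumps, and KEP determines \<open>f_rho_v\<close>. A pair with equal
  \<open>\<theta>\<close> is the limit of pairs with different \<open>\<theta>\<close>, by a perturbation of the right density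
  at fixed \<open>v\<close> and \<open>\<rho> \<theta>\<close>; continuity of both fluxes covers that case.
\<close>

section \<open>Cauchy means\<close>

text \<open>
  The Cauchy mean of \<open>F\<close> and \<open>G\<close> is the quotient of their increments, extended to the diagonal
  by \<open>a\<close>. It is a mean when \<open>F' x = x * G' x\<close> and \<open>G' > 0\<close>; then \<open>G\<close> is injective and the
  denominator does not vanish off the diagonal.
\<close>

definition cauchy_mean :: "(real \<Rightarrow> real) \<Rightarrow> (real \<Rightarrow> real) \<Rightarrow> real \<Rightarrow> real \<Rightarrow> real" where
  "cauchy_mean F G a b = (if a = b then a else (F b - F a) / (G b - G a))"

lemma cauchy_mean_same [simp]: "cauchy_mean F G a a = a"
  by (simp add: cauchy_mean_def)

lemma cauchy_mean_commute: "cauchy_mean F G a b = cauchy_mean F G b a"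
proof -
  have "(F b - F a) / (G b - G a) = (F a - F b) / (G a - G b)"
    using minus_divide_divide[of "F b - F a" "G b - G a"] by simp
  then show ?thesis
    by (simp add: cauchy_mean_def)
qed

lemma cauchy_mean_jump:
  assumes "inj_on G S" "a \<in> S" "b \<in> S"
  shows "(G b - G a) * cauchy_mean F G a b = F b - F a"
  using assms by (auto simp: cauchy_mean_def inj_on_eq_iff)

lemma deriv_pos_imp_less:
  fixes G :: "real \<Rightarrow> real"
  assumes G: "\<And>x. x > 0 \<Longrightarrow> (G has_real_derivative G' x) (at x)"
    and G'_pos: "\<And>x. x > 0 \<Longrightarrow> G' x > 0"
    and "0 < a" "a < b"
  shows "G a < G b"
proof (rule DERIV_pos_imp_increasing[OF \<open>a < b\<close>])
  fix x
  assume "a \<le> x" "x \<le> b"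
  with \<open>0 < a\<close> have "x > 0"
    by simp
  then show "\<exists>y. (G has_real_derivative y) (at x) \<and> y > 0"
    using G G'_pos by blast
qed

text \<open>
  Cauchy's mean value theorem gives \<open>F b - F a = (G b - G a) * c\<close> with \<open>c\<close> between \<open>a\<close> and \<open>b\<close>,
  because \<open>F' c / G' c = c\<close>.
\<close>

lemma cauchy_mean_between:
  assumes F: "\<And>x. x > 0 \<Longrightarrow> (F has_real_derivative x * G' x) (at x)"
    and G: "\<And>x. x > 0 \<Longrightarrow> (G has_real_derivative G' x) (at x)"
    and G'_pos: "\<And>x. x > 0 \<Longrightarrow> G' x > 0"
    and "a > 0" "b > 0"
  shows "cauchy_mean F G a b \<in> {min a b..max a b}"
proof -
  have *: "cauchy_mean F G a b \<in> {a..b}" if "0 < a" "a < b" for a b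
  proof -
    have "\<exists>c. a < c \<and> c < b \<and> (F b - F a) * G' c = (G b - G a) * (c * G' c)"
      using that
      by (intro GMVT'[where f = F and g = G and f' = "\<lambda>x. x * G' x" and g' = G'])
        (simp_all add: F G DERIV_isCont[OF F] DERIV_isCont[OF G])
    then obtain c where c: "a < c" "c < b" and eq: "(F b - F a) * G' c = (G b - G a) * (c * G' c)"
      by blast
    have "c > 0"
      using c that by simp
    from eq G'_pos[OF \<open>c > 0\<close>] have "F b - F a = (G b - G a) * c"
      by simp
    moreover have "G a < G b"
      using deriv_pos_imp_less[OF G G'_pos that] .
    ultimately have "cauchy_mean F G a b = c"
      using that by (simp add: cauchy_mean_def)
    then show ?thesis
      using c by simp
  qed
  show ?thesis
    using *[of a b] *[of b a, unfolded cauchy_mean_commute[of F G b a]] assms(4,5)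
    by (cases a b rule: linorder_cases) auto
qed

text \<open>
  Off the diagonal the mean is a quotient of continuous functions; on the diagonal it is squeezed
  between the minimum and the maximum of its arguments.
\<close>

lemma continuous_on_cauchy_mean:
  assumes F: "\<And>x. x > 0 \<Longrightarrow> (F has_real_derivative x * G' x) (at x)"
    and G: "\<And>x. x > 0 \<Longrightarrow> (G has_real_derivative G' x) (at x)"
    and G'_pos: "\<And>x. x > 0 \<Longrightarrow> G' x > 0"
    and p: "continuous_on D p" "\<And>z. z \<in> D \<Longrightarrow> p z > 0"
    and q: "continuous_on D q" "\<And>z. z \<in> D \<Longrightarrow> q z > 0"
  shows "continuous_on D (\<lambda>z. cauchy_mean F G (p z) (q z))"
  unfolding continuous_on_def
proof
  fix z
  assume z: "z \<in> D"
  define A where "A = at z within D"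
  have lim: "(p \<longlongrightarrow> p z) A" "(q \<longlongrightarrow> q z) A"
    using p(1) q(1) z unfolding A_def continuous_on_def by blast+
  have mem: "\<forall>\<^sub>F w in A. w \<in> D"
    unfolding A_def by (simp add: eventually_at_filter)
  show "((\<lambda>w. cauchy_mean F G (p w) (q w)) \<longlongrightarrow> cauchy_mean F G (p z) (q z)) A"
  proof (cases "p z = q z")
    case True
    have between: "\<forall>\<^sub>F w in A. min (p w) (q w) \<le> cauchy_mean F G (p w) (q w)"
      "\<forall>\<^sub>F w in A. cauchy_mean F G (p w) (q w) \<le> max (p w) (q w)"
      by (rule eventually_mono[OF mem], use cauchy_mean_between[OF F G G'_pos p(2) q(2)] in simp)+
    show ?thesis
    proof (rule tendsto_sandwich[OF between])
      show "((\<lambda>w. min (p w) (q w)) \<longlongrightarrow> cauchy_mean F G (p z) (q z)) A"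
        using tendsto_min[OF lim] True by simp
      show "((\<lambda>w. max (p w) (q w)) \<longlongrightarrow> cauchy_mean F G (p z) (q z)) A"
        using tendsto_max[OF lim] True by simp
    qed
  next
    case False
    have "\<forall>\<^sub>F w in A. p w - q w \<noteq> 0"
      by (rule tendsto_imp_eventually_ne[OF tendsto_diff[OF lim]]) (use False in simp)
    then have "\<forall>\<^sub>F w in A. (F (q w) - F (p w)) / (G (q w) - G (p w)) =
        cauchy_mean F G (p w) (q w)"
      by (rule eventually_mono) (simp add: cauchy_mean_def)
    moreover have "((\<lambda>w. (F (q w) - F (p w)) / (G (q w) - G (p w))) \<longlongrightarrow>
        cauchy_mean F G (p z) (q z)) A"
    proof -
      have "isCont F (p z)" "isCont F (q z)" "isCont G (p z)" "isCont G (q z)"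
        using p(2) q(2) z by (auto intro!: DERIV_isCont[OF F] DERIV_isCont[OF G])
      moreover have "G (q z) - G (p z) \<noteq> 0"
        using deriv_pos_imp_less[OF G G'_pos p(2)[OF z], of "q z"]
          deriv_pos_imp_less[OF G G'_pos q(2)[OF z], of "p z"] False
        by (cases "p z" "q z" rule: linorder_cases) simp_all
      ultimately have "((\<lambda>w. (F (q w) - F (p w)) / (G (q w) - G (p w))) \<longlongrightarrow>
          (F (q z) - F (p z)) / (G (q z) - G (p z))) A"
        by (intro tendsto_intros isCont_tendsto_compose[of _ F] isCont_tendsto_compose[of _ G] lim)
      then show ?thesis
        using False by (simp add: cauchy_mean_def)
    qed
    ultimately show ?thesis
      by (rule Lim_transform_eventually[rotated])
  qed
qed

section \<open>The logarithmic mean and the \<gamma>-mean\<close>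

text \<open>
  The constant factor in the numerator of the \<open>\<gamma>\<close>-mean is the one that makes \<open>F' x = x * G' x\<close>.
\<close>

abbreviation log_cauchy_mean :: "real \<Rightarrow> real \<Rightarrow> real" where
  "log_cauchy_mean \<equiv> cauchy_mean (\<lambda>x. x) ln"

abbreviation gamma_cauchy_mean :: "real \<Rightarrow> real \<Rightarrow> real \<Rightarrow> real" where
  "gamma_cauchy_mean \<gamma> \<equiv>
     cauchy_mean (\<lambda>x. (\<gamma> - 1) / \<gamma> * x powr \<gamma>) (\<lambda>x. x powr (\<gamma> - 1))"

lemma log_mean_eq_cauchy_mean: "log_mean a uL uR = log_cauchy_mean (a uL) (a uR)"
  by (simp add: log_mean_def jump_def cauchy_mean_def)

lemma gamma_mean_eq_cauchy_mean: "gamma_mean \<gamma> a uL uR = gamma_cauchy_mean \<gamma> (a uL) (a uR)"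
  by (simp add: gamma_mean_def jump_def cauchy_mean_def right_diff_distrib)

lemma inj_on_ln_pos: "inj_on (ln :: real \<Rightarrow> real) {0<..}"
  by (simp add: inj_on_def)

lemma inj_on_powr_pos:
  assumes "p > (0 :: real)"
  shows "inj_on (\<lambda>x. x powr p) {0<..}"
proof (rule linorder_inj_onI')
  fix x y :: real
  assume "x \<in> {0<..}" "x < y"
  with assms have "x powr p < y powr p"
    by (intro powr_less_mono2) auto
  then show "x powr p \<noteq> y powr p"
    by simp
qed

lemma continuous_on_log_mean:
  assumes "continuous_on D (\<lambda>z. a (fst z))" "continuous_on D (\<lambda>z. a (snd z))"
    and "\<And>z. z \<in> D \<Longrightarrow> a (fst z) > 0" "\<And>z. z \<in> D \<Longrightarrow> a (snd z) > 0"
  shows "continuous_on D (\<lambda>z. log_mean a (fst z) (snd z))"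
  unfolding log_mean_eq_cauchy_mean
proof (rule continuous_on_cauchy_mean[where G' = "\<lambda>x. 1 / x"])
  fix x :: real
  assume "x > 0"
  then show "((\<lambda>x. x) has_real_derivative x * (1 / x)) (at x)"
    and "(ln has_real_derivative 1 / x) (at x)" and "0 < 1 / x"
    by (auto intro!: derivative_eq_intros)
qed (use assms in simp_all)

lemma continuous_on_gamma_mean:
  assumes "\<gamma> > 1"
    and "continuous_on D (\<lambda>z. a (fst z))" "continuous_on D (\<lambda>z. a (snd z))"
    and "\<And>z. z \<in> D \<Longrightarrow> a (fst z) > 0" "\<And>z. z \<in> D \<Longrightarrow> a (snd z) > 0"
  shows "continuous_on D (\<lambda>z. gamma_mean \<gamma> a (fst z) (snd z))"
  unfolding gamma_mean_eq_cauchy_mean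
proof (rule continuous_on_cauchy_mean[where G' = "\<lambda>x. (\<gamma> - 1) * x powr (\<gamma> - 2)"])
  fix x :: real
  assume x: "x > 0"
  show "((\<lambda>x. (\<gamma> - 1) / \<gamma> * x powr \<gamma>) has_real_derivative x * ((\<gamma> - 1) * x powr (\<gamma> - 2))) (at x)"
  proof -
    have "x * x powr (\<gamma> - 2) = x powr (\<gamma> - 1)"
      using x powr_mult_base[of x "\<gamma> - 2"] by simp
    then show ?thesis
      using x \<open>\<gamma> > 1\<close> by (auto intro!: derivative_eq_intros)
  qed
  show "((\<lambda>x. x powr (\<gamma> - 1)) has_real_derivative (\<gamma> - 1) * x powr (\<gamma> - 2)) (at x)"
    using x by (auto intro!: derivative_eq_intros)
  show "0 < (\<gamma> - 1) * x powr (\<gamma> - 2)"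
    using x \<open>\<gamma> > 1\<close> by simp
qed (use assms(2-) in simp_all)

lemma jump_ln_log_mean:
  assumes "a uL > 0" "a uR > 0"
  shows "jump (\<lambda>u. ln (a u)) uL uR * log_mean a uL uR = jump a uL uR"
  using cauchy_mean_jump[OF inj_on_ln_pos, of "a uL" "a uR" "\<lambda>x. x"] assms
  by (simp add: jump_def log_mean_eq_cauchy_mean)

lemma jump_powr_gamma_mean:
  assumes "\<gamma> > 1" "a uL > 0" "a uR > 0"
  shows "\<gamma> / (\<gamma> - 1) * (jump (\<lambda>u. a u powr (\<gamma> - 1)) uL uR * gamma_mean \<gamma> a uL uR) =
    jump (\<lambda>u. a u powr \<gamma>) uL uR"
proof -
  have "jump (\<lambda>u. a u powr (\<gamma> - 1)) uL uR * gamma_mean \<gamma> a uL uR =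
      (\<gamma> - 1) / \<gamma> * jump (\<lambda>u. a u powr \<gamma>) uL uR"
    using cauchy_mean_jump[OF inj_on_powr_pos, of "\<gamma> - 1" "a uL" "a uR"
        "\<lambda>x. (\<gamma> - 1) / \<gamma> * x powr \<gamma>"] assms
    by (simp add: jump_def gamma_mean_eq_cauchy_mean right_diff_distrib)
  then show ?thesis
    using assms(1) by simp
qed

section \<open>Properties of the ETEC flux\<close>

lemma states_iff: "u \<in> states \<longleftrightarrow> rho u > 0 \<and> rho_theta u > 0"
  by (auto simp: states_def theta_def zero_less_divide_iff)

lemma inverse_theta: "1 / theta u = rho u / rho_theta u"
  by (simp add: theta_def)

lemma flux_eq_iff:
  "f uL uR = g uL uR \<longleftrightarrow> f_rho f uL uR = f_rho g uL uR \<and>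
     f_rho_v f uL uR = f_rho_v g uL uR \<and> f_rho_theta f uL uR = f_rho_theta g uL uR"
  by (simp add: f_rho_def f_rho_v_def f_rho_theta_def prod_eq_iff)

lemma f_rho_theta_etec:
  "f_rho_theta (etec_flux K \<gamma>) uL uR = gamma_mean \<gamma> rho_theta uL uR * avg vel uL uR"
  by (simp add: f_rho_theta_def etec_flux_def Let_def)

lemma f_rho_etec:
  "f_rho (etec_flux K \<gamma>) uL uR =
     f_rho_theta (etec_flux K \<gamma>) uL uR * log_mean (\<lambda>u. rho u / rho_theta u) uL uR"
  by (simp add: f_rho_def f_rho_theta_def etec_flux_def Let_def inverse_theta)

lemma f_rho_v_etec:
  "f_rho_v (etec_flux K \<gamma>) uL uR =
     f_rho (etec_flux K \<gamma>) uL uR * avg vel uL uR + avg (pressure K \<gamma>) uL uR"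
  by (simp add: f_rho_def f_rho_v_def etec_flux_def Let_def)

lemma numerical_flux_etec: "numerical_flux K \<gamma> (etec_flux K \<gamma>)"
  unfolding numerical_flux_def
proof (intro conjI ballI)
  fix uL uR
  show "etec_flux K \<gamma> uL uR = etec_flux K \<gamma> uR uL"
    by (simp add: etec_flux_def Let_def log_mean_eq_cauchy_mean gamma_mean_eq_cauchy_mean avg_def
        cauchy_mean_commute add.commute)
next
  fix u
  assume "u \<in> states"
  then show "etec_flux K \<gamma> u u = euler_flux K \<gamma> u"
    by (simp add: states_iff etec_flux_def euler_flux_def Let_def log_mean_def gamma_mean_def
        avg_def theta_def power2_eq_square)
qed

lemma EC_on_etec: "EC_on state_pairs (etec_flux K \<gamma>)"
  unfolding EC_on_def
proof clarify
  fix uL uR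
  assume "(uL, uR) \<in> state_pairs"
  then have "rho uL / rho_theta uL > 0" "rho uR / rho_theta uR > 0"
    by (auto simp: state_pairs_def states_iff)
  from jump_ln_log_mean[of "\<lambda>u. rho u / rho_theta u", OF this]
  show "jump (\<lambda>u. ln (rho u / rho_theta u)) uL uR * f_rho (etec_flux K \<gamma>) uL uR
      - jump (\<lambda>u. rho u / rho_theta u) uL uR * f_rho_theta (etec_flux K \<gamma>) uL uR = 0"
    by (simp add: f_rho_etec flip: mult.assoc)
qed

lemma KEP_on_etec: "KEP_on K \<gamma> D (etec_flux K \<gamma>)"
  by (auto simp: KEP_on_def f_rho_v_etec)

lemma TEC_on_etec:
  assumes "\<gamma> > 1"
  shows "TEC_on K \<gamma> state_pairs (etec_flux K \<gamma>)"
  unfolding TEC_on_def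
proof clarify
  fix uL uR
  assume "(uL, uR) \<in> state_pairs"
  then have "rho_theta uL > 0" "rho_theta uR > 0"
    by (auto simp: state_pairs_def states_iff)
  let ?f = "etec_flux K \<gamma>"
  have "\<gamma> / (\<gamma> - 1) * K * jump (\<lambda>u. rho_theta u powr (\<gamma> - 1)) uL uR * f_rho_theta ?f uL uR =
      K * (\<gamma> / (\<gamma> - 1) * (jump (\<lambda>u. rho_theta u powr (\<gamma> - 1)) uL uR *
        gamma_mean \<gamma> rho_theta uL uR)) * avg vel uL uR"
    by (simp add: f_rho_theta_etec)
  also have "\<dots> = K * jump (\<lambda>u. rho_theta u powr \<gamma>) uL uR * avg vel uL uR"
    by (simp only: jump_powr_gamma_mean[OF assms \<open>rho_theta uL > 0\<close> \<open>rho_theta uR > 0\<close>])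
  finally have pressure_term:
    "\<gamma> / (\<gamma> - 1) * K * jump (\<lambda>u. rho_theta u powr (\<gamma> - 1)) uL uR * f_rho_theta ?f uL uR =
      K * jump (\<lambda>u. rho_theta u powr \<gamma>) uL uR * avg vel uL uR" .
  \<comment> \<open>With KEP the kinetic energy fluxes cancel, since \<open>jump (v\<^sup>2) / 2 = avg v * jump v\<close>.\<close>
  have kinetic_term: "- (1 / 2) * jump (\<lambda>u. (vel u)\<^sup>2) uL uR * f_rho ?f uL uR
      + jump vel uL uR * f_rho_v ?f uL uR = jump vel uL uR * avg (pressure K \<gamma>) uL uR"
    unfolding f_rho_v_etec by (simp add: jump_def avg_def field_simps power2_eq_square)
  show "- (1 / 2) * jump (\<lambda>u. (vel u)\<^sup>2) uL uR * f_rho ?f uL uR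
      + jump vel uL uR * f_rho_v ?f uL uR
      + \<gamma> / (\<gamma> - 1) * K * jump (\<lambda>u. rho_theta u powr (\<gamma> - 1)) uL uR * f_rho_theta ?f uL uR
      - K * jump (\<lambda>u. rho_theta u powr \<gamma> * vel u) uL uR = 0"
    unfolding pressure_term kinetic_term
    by (simp add: jump_def avg_def pressure_def algebra_simps add_divide_distrib
        diff_divide_distrib)
qed

lemma pressure_eq_imp_rho_theta_eq:
  assumes "K > 0" "\<gamma> > 1" "uL \<in> states" "uR \<in> states" "pressure K \<gamma> uL = pressure K \<gamma> uR"
  shows "rho_theta uL = rho_theta uR"
  using assms inj_onD[OF inj_on_powr_pos, of \<gamma> "rho_theta uL" "rho_theta uR"]
  by (simp add: pressure_def states_iff)

text \<open>
  The quantities required by PEP are \<open>const(p, v) = p\<close> and \<open>const(\<rho> \<theta>, v) = (\<rho> \<theta>) * v\<close>.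
\<close>

lemma PEP_on_etec:
  assumes "K > 0" "\<gamma> > 1"
  shows "PEP_on K \<gamma> state_pairs (etec_flux K \<gamma>)"
  unfolding PEP_on_def
proof (rule exI[of _ "\<lambda>p v. p"], rule exI[of _ "\<lambda>q v. q * v"], clarify)
  fix uL uR
  assume "(uL, uR) \<in> state_pairs" and v: "vel uL = vel uR"
    and p: "pressure K \<gamma> uL = pressure K \<gamma> uR"
  then have "rho_theta uL = rho_theta uR"
    using assms pressure_eq_imp_rho_theta_eq by (auto simp: state_pairs_def)
  then show "f_rho_v (etec_flux K \<gamma>) uL uR =
      vel uL * f_rho (etec_flux K \<gamma>) uL uR + pressure K \<gamma> uL \<and>
      f_rho_theta (etec_flux K \<gamma>) uL uR = rho_theta uL * vel uL"
    using v p by (simp add: f_rho_v_etec f_rho_theta_etec gamma_mean_def avg_def)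
qed

lemma continuous_flux_on_etec:
  assumes "\<gamma> > 1"
  shows "continuous_flux_on state_pairs (etec_flux K \<gamma>)"
proof -
  have pos: "rho (fst z) > 0" "rho (snd z) > 0" "rho_theta (fst z) > 0" "rho_theta (snd z) > 0"
    if "z \<in> state_pairs" for z
    using that by (auto simp: state_pairs_def states_iff)
  then have ne: "\<forall>z\<in>state_pairs. rho (fst z) \<noteq> 0" "\<forall>z\<in>state_pairs. rho (snd z) \<noteq> 0"
    "\<forall>z\<in>state_pairs. rho_theta (fst z) \<noteq> 0" "\<forall>z\<in>state_pairs. rho_theta (snd z) \<noteq> 0"
    using less_irrefl by metis+
  have cont: "continuous_on state_pairs (\<lambda>z. rho (fst z))"
    "continuous_on state_pairs (\<lambda>z. rho (snd z))"
    "continuous_on state_pairs (\<lambda>z. rho_v (fst z))"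
    "continuous_on state_pairs (\<lambda>z. rho_v (snd z))"
    "continuous_on state_pairs (\<lambda>z. rho_theta (fst z))"
    "continuous_on state_pairs (\<lambda>z. rho_theta (snd z))"
    unfolding rho_def rho_v_def rho_theta_def by (intro continuous_intros)+
  have mean_vel: "continuous_on state_pairs (\<lambda>z. avg vel (fst z) (snd z))"
    unfolding avg_def vel_def by (intro continuous_intros cont) (simp_all add: ne)
  have mean_p: "continuous_on state_pairs (\<lambda>z. avg (pressure K \<gamma>) (fst z) (snd z))"
    unfolding avg_def pressure_def by (intro continuous_intros cont) (simp_all add: ne)
  have mean_rho_theta: "continuous_on state_pairs (\<lambda>z. gamma_mean \<gamma> rho_theta (fst z) (snd z))"
    by (intro continuous_on_gamma_mean assms cont pos)
  have mean_inv_theta: "continuous_on state_pairs (\<lambda>z. log_mean (\<lambda>u. 1 / theta u) (fst z) (snd z))"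
    unfolding inverse_theta
    by (intro continuous_on_log_mean continuous_intros cont divide_pos_pos pos) (simp_all add: ne)
  show ?thesis
    unfolding continuous_flux_on_def case_prod_beta etec_flux_def Let_def
    by (intro continuous_intros mean_vel mean_p mean_rho_theta mean_inv_theta)
qed

section \<open>Uniqueness at equal velocities\<close>

lemma equal_velocity_pairs_iff:
  "(uL, uR) \<in> equal_velocity_pairs \<longleftrightarrow> uL \<in> states \<and> uR \<in> states \<and> vel uL = vel uR"
  by (auto simp: equal_velocity_pairs_def state_pairs_def)

lemma f_rho_theta_unique:
  assumes "K > 0" "\<gamma> > 1" "numerical_flux K \<gamma> f"
    and TEC: "TEC_on K \<gamma> equal_velocity_pairs f"
    and PEP: "PEP_on K \<gamma> equal_velocity_pairs f"
    and mem: "(uL, uR) \<in> equal_velocity_pairs"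
  shows "f_rho_theta f uL uR = f_rho_theta (etec_flux K \<gamma>) uL uR"
proof -
  from mem have L: "uL \<in> states" and R: "uR \<in> states" and v: "vel uL = vel uR"
    by (auto simp: equal_velocity_pairs_iff)
  have q_pos: "rho_theta uL > 0" "rho_theta uR > 0"
    using L R by (auto simp: states_iff)
  show ?thesis
  proof (cases "rho_theta uL = rho_theta uR")
    case True
    \<comment> \<open>The pair \<open>(uL, uL)\<close> has the same velocity and the same \<open>\<rho> \<theta>\<close>, so PEP gives it the same
       \<open>f_rho_theta\<close>.\<close>
    from PEP obtain d where "\<forall>(wL, wR)\<in>equal_velocity_pairs.
        vel wL = vel wR \<and> pressure K \<gamma> wL = pressure K \<gamma> wR \<longrightarrow>
        f_rho_theta f wL wR = d (rho_theta wL) (vel wL)"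
      unfolding PEP_on_def by fast
    then have d: "f_rho_theta f wL wR = d (rho_theta wL) (vel wL)"
      if "(wL, wR) \<in> equal_velocity_pairs" "pressure K \<gamma> wL = pressure K \<gamma> wR" for wL wR
      using that equal_velocity_pairs_iff by fast
    have "f_rho_theta f uL uR = f_rho_theta f uL uL"
      using d[of uL uR] d[of uL uL] mem L True by (simp add: equal_velocity_pairs_iff pressure_def)
    also have "\<dots> = rho_theta uL * vel uL"
      using \<open>numerical_flux K \<gamma> f\<close> L by (simp add: numerical_flux_def f_rho_theta_def euler_flux_def)
    finally show ?thesis
      using True v by (simp add: f_rho_theta_etec gamma_mean_def avg_def)
  next
    case False
    let ?J = "jump (\<lambda>u. rho_theta u powr (\<gamma> - 1)) uL uR"
    have jump_eq: "\<gamma> / (\<gamma> - 1) * K * ?J * f_rho_theta f uL uR =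
        K * jump (\<lambda>u. rho_theta u powr \<gamma> * vel u) uL uR"
      if "TEC_on K \<gamma> {(uL, uR)} f" for f
      using that v by (simp add: TEC_on_def jump_def)
    have "TEC_on K \<gamma> {(uL, uR)} f" "TEC_on K \<gamma> {(uL, uR)} (etec_flux K \<gamma>)"
      using TEC TEC_on_etec[OF \<open>\<gamma> > 1\<close>, of K] mem L R
      by (auto simp: TEC_on_def state_pairs_def)
    from this[THEN jump_eq] have "\<gamma> / (\<gamma> - 1) * K * ?J * f_rho_theta f uL uR =
        \<gamma> / (\<gamma> - 1) * K * ?J * f_rho_theta (etec_flux K \<gamma>) uL uR"
      by simp
    moreover have "?J \<noteq> 0"
      using inj_onD[OF inj_on_powr_pos, of "\<gamma> - 1" "rho_theta uR" "rho_theta uL"] q_pos False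
        \<open>\<gamma> > 1\<close> by (auto simp: jump_def)
    ultimately show ?thesis
      using \<open>K > 0\<close> \<open>\<gamma> > 1\<close> by simp
  qed
qed

lemma flux_unique_if_theta_ne:
  assumes "K > 0" "\<gamma> > 1" "numerical_flux K \<gamma> f"
    and EC: "EC_on equal_velocity_pairs f"
    and "TEC_on K \<gamma> equal_velocity_pairs f"
    and KEP: "KEP_on K \<gamma> equal_velocity_pairs f"
    and "PEP_on K \<gamma> equal_velocity_pairs f"
    and mem: "(uL, uR) \<in> equal_velocity_pairs"
    and "theta uL \<noteq> theta uR"
  shows "f uL uR = etec_flux K \<gamma> uL uR"
proof -
  have mem': "(uL, uR) \<in> state_pairs"
    using mem by (simp add: equal_velocity_pairs_def)
  have rho_theta: "f_rho_theta f uL uR = f_rho_theta (etec_flux K \<gamma>) uL uR"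
    using assms by (intro f_rho_theta_unique)
  let ?J = "jump (\<lambda>u. ln (rho u / rho_theta u)) uL uR"
  have "?J * f_rho f uL uR = ?J * f_rho (etec_flux K \<gamma>) uL uR"
    using EC EC_on_etec[of K \<gamma>] mem mem' rho_theta unfolding EC_on_def by fastforce
  moreover have "?J \<noteq> 0"
  proof -
    have "rho uL / rho_theta uL \<noteq> rho uR / rho_theta uR"
      using \<open>theta uL \<noteq> theta uR\<close> unfolding inverse_theta[symmetric] by simp
    moreover have "rho uL / rho_theta uL > 0" "rho uR / rho_theta uR > 0"
      using mem' by (auto simp: state_pairs_def states_iff)
    ultimately show ?thesis
      unfolding jump_def using ln_inj_iff by fastforce
  qed
  ultimately have rho: "f_rho f uL uR = f_rho (etec_flux K \<gamma>) uL uR"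
    by simp
  have "f_rho_v f uL uR = f_rho_v (etec_flux K \<gamma>) uL uR"
    using KEP mem rho by (auto simp: KEP_on_def f_rho_v_etec)
  then show ?thesis
    using rho rho_theta by (simp add: flux_eq_iff)
qed

text \<open>
  Pairs with different \<open>\<theta>\<close> are dense among the pairs with equal velocities: at a pair with equal
  \<open>\<theta>\<close>, increase the right density by \<open>1 / (n + 1)\<close> at fixed velocity and fixed \<open>\<rho> \<theta>\<close>.
\<close>

lemma equal_velocity_pair_approx:
  assumes mem: "(uL, uR) \<in> equal_velocity_pairs" and "theta uL = theta uR"
  obtains w where "\<And>n::nat. (uL, w n) \<in> equal_velocity_pairs" "\<And>n. theta uL \<noteq> theta (w n)"
    "w \<longlonglongrightarrow> uR"
proof
  define r where "r n = rho uR + inverse (real (Suc n))" for n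
  define w where "w n = (r n, r n * vel uR, rho_theta uR)" for n
  have R: "rho uR > 0" "rho_theta uR > 0"
    using mem by (auto simp: equal_velocity_pairs_iff states_iff)
  have r: "r n > rho uR" "r n > 0" for n
    using R by (auto simp: r_def intro: add_pos_pos)
  show "(uL, w n) \<in> equal_velocity_pairs" for n
    using mem r(2)[of n] R unfolding equal_velocity_pairs_iff states_iff
    by (simp add: w_def rho_def rho_theta_def vel_def rho_v_def)
  show "theta uL \<noteq> theta (w n)" for n
  proof -
    have "theta (w n) = rho_theta uR / r n"
      by (simp add: w_def theta_def rho_def rho_theta_def)
    moreover have "\<dots> < rho_theta uR / rho uR"
      using R r(1)[of n] by (intro divide_strict_left_mono) auto
    ultimately show ?thesis
      using \<open>theta uL = theta uR\<close> theta_def[of uR] by linarith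
  qed
  have "r \<longlonglongrightarrow> rho uR + 0"
    unfolding r_def by (intro tendsto_add tendsto_const LIMSEQ_inverse_real_of_nat)
  then have "w \<longlonglongrightarrow> (rho uR, rho uR * vel uR, rho_theta uR)"
    unfolding w_def by (auto intro!: tendsto_intros)
  also have "(rho uR, rho uR * vel uR, rho_theta uR) = uR"
    using R by (simp add: vel_def) (simp add: rho_def rho_v_def rho_theta_def)
  finally show "w \<longlonglongrightarrow> uR" .
qed

lemma continuous_flux_on_tendsto:
  assumes "continuous_flux_on D f" "(uL, uR) \<in> D" "\<And>n. (uL, w n) \<in> D" "w \<longlonglongrightarrow> uR"
  shows "(\<lambda>n. f uL (w n)) \<longlonglongrightarrow> f uL uR"
proof -
  have "(\<lambda>n. (uL, w n)) \<longlonglongrightarrow> (uL, uR)"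
    using assms(4) by (intro tendsto_intros)
  from continuous_on_tendsto_compose[OF assms(1)[unfolded continuous_flux_on_def] this assms(2)]
  show ?thesis
    using assms(3) by simp
qed

lemma flux_unique_if_continuous:
  assumes "K > 0" "\<gamma> > 1" "numerical_flux K \<gamma> f"
    and "EC_on equal_velocity_pairs f" "TEC_on K \<gamma> equal_velocity_pairs f"
    and "KEP_on K \<gamma> equal_velocity_pairs f" "PEP_on K \<gamma> equal_velocity_pairs f"
    and cont: "continuous_flux_on equal_velocity_pairs f"
    and mem: "(uL, uR) \<in> equal_velocity_pairs"
  shows "f uL uR = etec_flux K \<gamma> uL uR"
proof (cases "theta uL = theta uR")
  case True
  from mem True obtain w where w: "\<And>n::nat. (uL, w n) \<in> equal_velocity_pairs"
    "\<And>n. theta uL \<noteq> theta (w n)" "w \<longlonglongrightarrow> uR"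
    using equal_velocity_pair_approx by blast
  have "f uL (w n) = etec_flux K \<gamma> uL (w n)" for n
    by (rule flux_unique_if_theta_ne[OF assms(1-7) w(1,2)])
  moreover have "(\<lambda>n. f uL (w n)) \<longlonglongrightarrow> f uL uR"
    by (rule continuous_flux_on_tendsto[OF cont mem w(1,3)])
  moreover have "(\<lambda>n. etec_flux K \<gamma> uL (w n)) \<longlonglongrightarrow> etec_flux K \<gamma> uL uR"
    using mem w by (intro continuous_flux_on_tendsto[OF continuous_flux_on_etec[OF \<open>\<gamma> > 1\<close>]])
      (auto simp: equal_velocity_pairs_def)
  ultimately show ?thesis
    by (simp add: LIMSEQ_unique)
next
  case False
  then show ?thesis
    by (rule flux_unique_if_theta_ne[OF assms(1-7) mem])
qed

theorem theorem3p4: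
  fixes K \<gamma> :: real
  assumes "K > 0" and "\<gamma> > 1"
  shows "(numerical_flux K \<gamma> (etec_flux K \<gamma>) \<and>
          continuous_flux_on state_pairs (etec_flux K \<gamma>) \<and>
          EC_on state_pairs (etec_flux K \<gamma>) \<and>
          TEC_on K \<gamma> state_pairs (etec_flux K \<gamma>) \<and>
          KEP_on K \<gamma> state_pairs (etec_flux K \<gamma>) \<and>
          PEP_on K \<gamma> state_pairs (etec_flux K \<gamma>)) \<and>
         (\<forall>f. numerical_flux K \<gamma> f \<and>
              EC_on equal_velocity_pairs f \<and>
              TEC_on K \<gamma> equal_velocity_pairs f \<and>
              KEP_on K \<gamma> equal_velocity_pairs f \<and>
              PEP_on K \<gamma> equal_velocity_pairs f \<longrightarrow>
              (\<forall>(uL, uR)\<in>equal_velocity_pairs.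
                 theta uL \<noteq> theta uR \<or> continuous_flux_on equal_velocity_pairs f \<longrightarrow>
                 f uL uR = etec_flux K \<gamma> uL uR))"
proof (intro conjI allI impI ballI)
  show "numerical_flux K \<gamma> (etec_flux K \<gamma>)"
    by (rule numerical_flux_etec)
  show "continuous_flux_on state_pairs (etec_flux K \<gamma>)"
    using assms(2) by (rule continuous_flux_on_etec)
  show "EC_on state_pairs (etec_flux K \<gamma>)"
    by (rule EC_on_etec)
  show "TEC_on K \<gamma> state_pairs (etec_flux K \<gamma>)"
    using assms(2) by (rule TEC_on_etec)
  show "KEP_on K \<gamma> state_pairs (etec_flux K \<gamma>)"
    by (rule KEP_on_etec)
  show "PEP_on K \<gamma> state_pairs (etec_flux K \<gamma>)"
    using assms by (rule PEP_on_etec)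
next
  fix f z
  assume f: "numerical_flux K \<gamma> f \<and> EC_on equal_velocity_pairs f \<and>
      TEC_on K \<gamma> equal_velocity_pairs f \<and> KEP_on K \<gamma> equal_velocity_pairs f \<and>
      PEP_on K \<gamma> equal_velocity_pairs f"
    and z: "z \<in> equal_velocity_pairs"
  obtain uL uR where z_eq: "z = (uL, uR)"
    by (rule prod.exhaust)
  have "f uL uR = etec_flux K \<gamma> uL uR"
    if "theta uL \<noteq> theta uR \<or> continuous_flux_on equal_velocity_pairs f"
    using that
  proof
    assume "theta uL \<noteq> theta uR"
    then show ?thesis
      using assms f z unfolding z_eq by (intro flux_unique_if_theta_ne[where f = f]) simp_all
  next
    assume "continuous_flux_on equal_velocity_pairs f"
    then show ?thesis
      using assms f z unfolding z_eq by (intro flux_unique_if_continuous[where f = f]) simp_all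
  qed
  then show "case z of (uL, uR) \<Rightarrow>
      theta uL \<noteq> theta uR \<or> continuous_flux_on equal_velocity_pairs f \<longrightarrow>
      f uL uR = etec_flux K \<gamma> uL uR"
    unfolding z_eq prod.case by (rule impI)
qed

end
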